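(* Let $\theta$ and $\rho$ be real numbers with $0\le\theta,\rho<1$ and $\theta$ irrational. Assume that either $\rho\notin \mathbb{Z}\theta+\mathbb{Z}$, or $\rho\in \mathbb{Z}_{\ge 1}\theta+\mathbb{Z}$. Then $\mathbf{s}_{\theta,\rho}=\mathbf{s}'_{\theta,\rho}$. Let $$\rho-\theta=\sum_{h\ge1} b_h\theta_{h-1}$$ be the Ostrowski expansion of $\rho-\theta$ in base $\theta$. Define words $V_{-1}=1$, $V_0=0$, $V_1=0^{a_1-b_1-1}\,1\,0^{b_1}$ and $$V_{k+1}=V_k^{a_{k+1}-b_{k+1}}\,V_{k-1}\,V_k^{b_{k+1}},\qquad k\ge1.$$ Then the sequence $(V_k)_{k\ge0}$ converges and $\mathbf{s}_{\theta,\rho}=\mathbf{s}'_{\theta,\rho}=\lim_{k\to\infty}V_k$. Furthermore, setting $t_k=b_1+b_2q_1+\cdots+b_kq_{k-1}$ and $r_k=q_k-t_k$, and denoting by $T_k$ (resp. $R_k$) the prefix of length $t_k$ (resp. the suffix of length $r_k$) of $M_k$ for $k\ge1$, we have $V_k=R_kT_k$ and $M_k=T_kR_k$ for all $k\ge1$.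
   Context: Let $\theta=[0;a_1,a_2,\dots]$ be the continued fraction expansion of $\theta$, with convergents $p_k/q_k$, where $q_{-1}=0$, $q_0=1$, $p_{-1}=1$, $p_0=0$ and $q_k=a_kq_{k-1}+q_{k-2}$, $p_k=a_kp_{k-1}+p_{k-2}$. Put $\theta_k=q_k\theta-p_k$ for $k\ge0$. For $n\ge1$ let $s_n=\lfloor n\theta+\rho\rfloor-\lfloor(n-1)\theta+\rho\rfloor$ and $s'_n=\lceil n\theta+\rho\rceil-\lceil(n-1)\theta+\rho\rceil$; the infinite words $\mathbf{s}_{\theta,\rho}=s_1s_2s_3\cdots$ and $\mathbf{s}'_{\theta,\rho}=s'_1s'_2s'_3\cdots$ over $\{0,1\}$ are the lower and upper Sturmian words of slope $\theta$ and intercept $\rho$. The words $M_k$ over $\{0,1\}$ are defined by $M_0=0$, $M_1=0^{a_1-1}1$, $M_k=M_{k-1}^{a_k}M_{k-2}$ for $k\ge2$ (so $|M_k|=q_k$). Ostrowski expansion: every real $\sigma\in[-\theta,1-\theta]$ which is either not in $\mathbb{Z}\theta+\mathbb{Z}$ or lies in $\mathbb{Z}_{\ge0}\theta+\mathbb{Z}$ can be written uniquely as $\sigma=\sum_{k\ge1}b_k\theta_{k-1}$ with integers $0\le b_1\le a_1-1$, $0\le b_k\le a_k$ ($k\ge2$), $b_k=0$ whenever $b_{k+1}=a_{k+1}$, and such that there are infinitely many odd $k$ and infinitely many even $k$ with $b_k<a_k$. Powers $W^n$ denote concatenation of $n$ copies of a word $W$, and convergence of words means convergence in the product topology (longer and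 longer common prefixes). *)

theory Defs
  imports Complex_Main
begin

section \<open>Continued fractions\<close>

primrec cf_complete :: "real \<Rightarrow> nat \<Rightarrow> real" where
  "cf_complete \<theta> 0 = \<theta>"
| "cf_complete \<theta> (Suc k) = 1 / frac (cf_complete \<theta> k)"

definition cf_a :: "real \<Rightarrow> nat \<Rightarrow> nat" where
  "cf_a \<theta> k = nat \<lfloor>cf_complete \<theta> k\<rfloor>"

text \<open>The convergents are indexed from \<open>0\<close>; the values at \<open>1\<close> are those produced by
  the recurrence from \<open>q\<^sub>-\<^sub>1 = 0\<close> and \<open>p\<^sub>-\<^sub>1 = 1\<close>.\<close>

fun cf_q :: "real \<Rightarrow> nat \<Rightarrow> nat" where
  "cf_q \<theta> 0 = 1"
| "cf_q \<theta> (Suc 0) = cf_a \<theta> 1 * 1 + 0"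
| "cf_q \<theta> (Suc (Suc k)) = cf_a \<theta> (Suc (Suc k)) * cf_q \<theta> (Suc k) + cf_q \<theta> k"

fun cf_p :: "real \<Rightarrow> nat \<Rightarrow> nat" where
  "cf_p \<theta> 0 = 0"
| "cf_p \<theta> (Suc 0) = cf_a \<theta> 1 * 0 + 1"
| "cf_p \<theta> (Suc (Suc k)) = cf_a \<theta> (Suc (Suc k)) * cf_p \<theta> (Suc k) + cf_p \<theta> k"

definition cf_diff :: "real \<Rightarrow> nat \<Rightarrow> real" where
  "cf_diff \<theta> k = real (cf_q \<theta> k) * \<theta> - real (cf_p \<theta> k)"

section \<open>Ostrowski expansions\<close>

text \<open>Digits are indexed from \<open>1\<close>; the value \<open>b 0\<close> is irrelevant.\<close>

definition ostrowski_expansion :: "real \<Rightarrow> real \<Rightarrow> (nat \<Rightarrow> nat) \<Rightarrow> bool" where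
  "ostrowski_expansion \<theta> \<sigma> b \<longleftrightarrow>
     b 1 \<le> cf_a \<theta> 1 - 1 \<and>
     (\<forall>k\<ge>2. b k \<le> cf_a \<theta> k) \<and>
     (\<forall>k\<ge>1. b (Suc k) = cf_a \<theta> (Suc k) \<longrightarrow> b k = 0) \<and>
     infinite {k. k \<ge> 1 \<and> odd k \<and> b k < cf_a \<theta> k} \<and>
     infinite {k. k \<ge> 1 \<and> even k \<and> b k < cf_a \<theta> k} \<and>
     (\<lambda>k. real (b (Suc k)) * cf_diff \<theta> k) sums \<sigma>"

section \<open>Words\<close>

text \<open>Finite words are lists and infinite words are functions on \<open>nat\<close>. An infinite word
  \<open>s\<^sub>1 s\<^sub>2 s\<^sub>3 \<dots>\<close> is the function sending the position \<open>i\<close>, counted from \<open>0\<close>,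
  to \<open>s\<^bsub>i+1\<^esub>\<close>.\<close>

definition word_power :: "'a list \<Rightarrow> nat \<Rightarrow> 'a list" where
  "word_power w n = concat (replicate n w)"

text \<open>Convergence of finite words to an infinite word in the product topology: every finite
  prefix of the limit is eventually a prefix of the terms (in particular, the lengths of the
  terms tend to infinity).\<close>

definition words_tendsto :: "(nat \<Rightarrow> 'a list) \<Rightarrow> (nat \<Rightarrow> 'a) \<Rightarrow> bool" where
  "words_tendsto W w \<longleftrightarrow>
     (\<forall>n. \<forall>\<^sub>F k in sequentially. n \<le> length (W k) \<and> take n (W k) = map w [0..<n])"

definition word_prefix :: "nat \<Rightarrow> 'a list \<Rightarrow> 'a list" where
  "word_prefix n w = take n w"

definition word_suffix :: "nat \<Rightarrow> 'a list \<Rightarrow> 'a list" where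
  "word_suffix n w = drop (length w - n) w"

section \<open>Sturmian words\<close>

definition lower_letter :: "real \<Rightarrow> real \<Rightarrow> nat \<Rightarrow> int" where
  "lower_letter \<theta> \<rho> n = \<lfloor>real n * \<theta> + \<rho>\<rfloor> - \<lfloor>(real n - 1) * \<theta> + \<rho>\<rfloor>"

definition upper_letter :: "real \<Rightarrow> real \<Rightarrow> nat \<Rightarrow> int" where
  "upper_letter \<theta> \<rho> n = \<lceil>real n * \<theta> + \<rho>\<rceil> - \<lceil>(real n - 1) * \<theta> + \<rho>\<rceil>"

definition lower_sturmian :: "real \<Rightarrow> real \<Rightarrow> nat \<Rightarrow> int" where
  "lower_sturmian \<theta> \<rho> = (\<lambda>i. lower_letter \<theta> \<rho> (Suc i))"

definition upper_sturmian :: "real \<Rightarrow> real \<Rightarrow> nat \<Rightarrow> int" where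
  "upper_sturmian \<theta> \<rho> = (\<lambda>i. upper_letter \<theta> \<rho> (Suc i))"

fun M_word :: "real \<Rightarrow> nat \<Rightarrow> int list" where
  "M_word \<theta> 0 = [0]"
| "M_word \<theta> (Suc 0) = word_power [0] (cf_a \<theta> 1 - 1) @ [1]"
| "M_word \<theta> (Suc (Suc k)) =
     word_power (M_word \<theta> (Suc k)) (cf_a \<theta> (Suc (Suc k))) @ M_word \<theta> k"

text \<open>The word \<open>V\<^sub>-\<^sub>1 = 1\<close> is not represented: it is not used by the recursion, which
  starts from \<open>V\<^sub>0\<close> and \<open>V\<^sub>1\<close>. For the digits of an Ostrowski expansion the subtractions
  on \<open>nat\<close> below do not truncate.\<close>

fun V_word :: "real \<Rightarrow> (nat \<Rightarrow> nat) \<Rightarrow> nat \<Rightarrow> int list" where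
  "V_word \<theta> b 0 = [0]"
| "V_word \<theta> b (Suc 0) = word_power [0] (cf_a \<theta> 1 - b 1 - 1) @ [1] @ word_power [0] (b 1)"
| "V_word \<theta> b (Suc (Suc k)) =
     word_power (V_word \<theta> b (Suc k)) (cf_a \<theta> (Suc (Suc k)) - b (Suc (Suc k)))
     @ V_word \<theta> b k
     @ word_power (V_word \<theta> b (Suc k)) (b (Suc (Suc k)))"

definition ost_t :: "real \<Rightarrow> (nat \<Rightarrow> nat) \<Rightarrow> nat \<Rightarrow> nat" where
  "ost_t \<theta> b k = (\<Sum>i=1..k. b i * cf_q \<theta> (i - 1))"

definition ost_r :: "real \<Rightarrow> (nat \<Rightarrow> nat) \<Rightarrow> nat \<Rightarrow> nat" where
  "ost_r \<theta> b k = cf_q \<theta> k - ost_t \<theta> b k"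

definition T_word :: "real \<Rightarrow> (nat \<Rightarrow> nat) \<Rightarrow> nat \<Rightarrow> int list" where
  "T_word \<theta> b k = word_prefix (ost_t \<theta> b k) (M_word \<theta> k)"

definition R_word :: "real \<Rightarrow> (nat \<Rightarrow> nat) \<Rightarrow> nat \<Rightarrow> int list" where
  "R_word \<theta> b k = word_suffix (ost_r \<theta> b k) (M_word \<theta> k)"

lemma length_word_power: "length (word_power w n) = n * length w"
  by (induction n) (simp_all add: word_power_def)

lemma cf_a_1_pos:
  assumes "0 \<le> \<theta>" "\<theta> < 1" "\<theta> \<notin> \<rat>"
  shows "cf_a \<theta> 1 \<ge> 1"
proof -
  have "\<theta> \<noteq> 0" using assms(3) by auto
  hence "0 < \<theta>" using assms(1) by simp
  moreover have "frac \<theta> = \<theta>" using assms by (simp add: frac_eq)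
  ultimately have "cf_complete \<theta> 1 \<ge> 1" using assms(2) by simp
  hence "\<lfloor>cf_complete \<theta> 1\<rfloor> \<ge> 1" by linarith
  thus ?thesis unfolding cf_a_def by linarith
qed

lemma length_M_word:
  assumes "0 \<le> \<theta>" "\<theta> < 1" "\<theta> \<notin> \<rat>"
  shows "length (M_word \<theta> k) = cf_q \<theta> k"
  using cf_a_1_pos[OF assms]
  by (induction \<theta> k rule: M_word.induct) (simp_all add: length_word_power)

end

theory Submission
  imports Defs
begin

text \<open>The word \<open>V\<^sub>k\<close> is the rotation of \<open>M\<^sub>k\<close> by \<open>t\<^sub>k\<close>, by a computation with words. Moreover
  \<open>M\<^sub>k\<close> is a prefix of the Sturmian word of slope and intercept \<open>\<theta>\<close>, and by the best approximation
  property of \<open>p\<^sub>k/q\<^sub>k\<close> that word has period \<open>q\<^sub>k\<close> on a prefix long enough to contain \<open>T\<^sub>k R\<^sub>k T\<^sub>k\<close>.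
  Hence \<open>V\<^sub>k\<close> is a prefix of the Sturmian word of intercept
  \<open>\<rho>\<^sub>k = \<theta> + \<Sum>\<^bsub>h \<le> k\<^esub> b\<^sub>h \<theta>\<^bsub>h-1\<^esub> \<equiv> (t\<^sub>k + 1) \<theta> (mod 1)\<close>. As \<open>\<rho>\<^sub>k \<rightarrow> \<rho>\<close> and no
  \<open>n \<theta> + \<rho>\<close> is an integer, the letters of these words converge.\<close>

section \<open>Powers of words\<close>

lemma word_power_0 [simp]: "word_power w 0 = []"
  by (simp add: word_power_def)

lemma word_power_Suc [simp]: "word_power w (Suc n) = w @ word_power w n"
  by (simp add: word_power_def)

lemma word_power_add: "word_power w (m + n) = word_power w m @ word_power w n"
  by (induction m) simp_all

lemma word_power_commute: "word_power w n @ w = w @ word_power w n"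
  by (induction n) simp_all

lemma word_power_commute_append: "word_power w n @ w @ v = w @ word_power w n @ v"
  by (metis append_assoc word_power_commute)

lemma word_power_rotate: "word_power (u @ v) n @ u = u @ word_power (v @ u) n"
  by (induction n) simp_all

lemma word_power_singleton: "word_power [x] n = replicate n x"
  by (induction n) simp_all

lemma nth_word_power:
  assumes "i < n * length w"
  shows "word_power w n ! i = w ! (i mod length w)"
  using assms
proof (induction n arbitrary: i)
  case (Suc n)
  then show ?case
    by (cases "i < length w") (auto simp: nth_append le_mod_geq)
qed simp

section \<open>Continued fractions of irrational numbers\<close>

lemma irrational_linear_not_Int:
  assumes "(\<theta>::real) \<notin> \<rat>" and "m \<noteq> 0"
  shows "of_int m * \<theta> + of_int n \<notin> \<int>"
proof
  assume "of_int m * \<theta> + of_int n \<in> \<int>"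
  then obtain l where "of_int m * \<theta> + of_int n = of_int l"
    by (rule Ints_cases)
  then have "\<theta> = of_int (l - n) / of_int m"
    using assms(2) by (simp add: field_simps)
  then show False
    using assms(1) by (metis Rats_divide Rats_of_int)
qed

locale irrational_slope =
  fixes \<theta> :: real
  assumes slope_ge_0: "0 \<le> \<theta>" and slope_less_1: "\<theta> < 1" and irrational: "\<theta> \<notin> \<rat>"
begin

lemma slope_pos: "0 < \<theta>"
  using slope_ge_0 irrational by (cases "\<theta> = 0") auto

section \<open>Complete and partial quotients\<close>

lemma cf_complete_irrational: "cf_complete \<theta> k \<notin> \<rat>"
proof (induction k)
  case 0
  then show ?case using irrational by simp
next
  case (Suc k)
  show ?case
  proof
    assume "cf_complete \<theta> (Suc k) \<in> \<rat>"
    then have "1 / cf_complete \<theta> (Suc k) \<in> \<rat>" by (intro Rats_divide) auto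
    then have "frac (cf_complete \<theta> k) \<in> \<rat>" by simp
    then have "frac (cf_complete \<theta> k) + of_int \<lfloor>cf_complete \<theta> k\<rfloor> \<in> \<rat>"
      by (intro Rats_add) auto
    then show False using Suc by (simp add: frac_def)
  qed
qed

lemma frac_cf_complete_pos: "0 < frac (cf_complete \<theta> k)"
  using cf_complete_irrational[of k] Ints_subset_Rats by (auto simp: frac_gt_0_iff)

lemma cf_complete_Suc_gt_1: "cf_complete \<theta> (Suc k) > 1"
  using frac_cf_complete_pos[of k] frac_lt_1[of "cf_complete \<theta> k"] by simp

lemma cf_a_Suc: "real (cf_a \<theta> (Suc k)) = 1 / frac (cf_complete \<theta> k) - frac (cf_complete \<theta> (Suc k))"
  using cf_complete_Suc_gt_1[of k] by (simp add: cf_a_def frac_def)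

lemma cf_a_Suc_pos: "1 \<le> cf_a \<theta> (Suc k)"
  using cf_complete_Suc_gt_1[of k] unfolding cf_a_def by linarith

section \<open>Growth of the denominators\<close>

lemma cf_q_pos: "0 < cf_q \<theta> k"
proof (induction k rule: induct_nat_012)
  case 1
  then show ?case using cf_a_Suc_pos[of 0] by simp
next
  case (ge2 k)
  then show ?case by simp
qed simp

text \<open>Strictness starts at index 1: q_0 = q_1 = 1 when a_1 = 1.\<close>

lemma cf_q_strict: "cf_q \<theta> (Suc k) < cf_q \<theta> (Suc (Suc k))"
proof -
  have "1 * cf_q \<theta> (Suc k) \<le> cf_a \<theta> (Suc (Suc k)) * cf_q \<theta> (Suc k)"
    using cf_a_Suc_pos by (rule mult_le_mono1)
  then show ?thesis using cf_q_pos[of k] by (simp only: cf_q.simps)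
qed

lemma cf_q_ge: "k \<le> cf_q \<theta> k"
proof (induction k rule: induct_nat_012)
  case 1
  then show ?case using cf_a_Suc_pos[of 0] by simp
next
  case (ge2 k)
  then show ?case using cf_q_strict[of k] by linarith
qed simp

section \<open>Signed errors of the convergents\<close>

lemma cf_diff_0: "cf_diff \<theta> 0 = \<theta>"
  by (simp add: cf_diff_def)

lemma cf_diff_Suc_Suc:
  "cf_diff \<theta> (Suc (Suc k)) = real (cf_a \<theta> (Suc (Suc k))) * cf_diff \<theta> (Suc k) + cf_diff \<theta> k"
  by (simp add: cf_diff_def algebra_simps)

text \<open>The factor multiplying \<open>cf_diff \<theta> k\<close> lies strictly between -1 and 0,
  so this one formula yields both the alternating signs and the decrease of the errors.\<close>

lemma cf_diff_Suc: "cf_diff \<theta> (Suc k) = - cf_diff \<theta> k * frac (cf_complete \<theta> (Suc k))"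
proof (induction k)
  case 0
  have "frac \<theta> = \<theta>" using slope_ge_0 slope_less_1 by (simp add: frac_eq)
  then have "real (cf_a \<theta> (Suc 0)) = 1 / \<theta> - frac (cf_complete \<theta> (Suc 0))"
    using cf_a_Suc[of 0] by simp
  then have "\<theta> * real (cf_a \<theta> (Suc 0)) = 1 - \<theta> * frac (cf_complete \<theta> (Suc 0))"
    using slope_pos by (simp add: right_diff_distrib)
  then show ?case
    by (simp add: cf_diff_def algebra_simps del: cf_complete.simps)
next
  case (Suc k)
  define x where "x = frac (cf_complete \<theta> (Suc k))"
  have x: "0 < x" unfolding x_def by (rule frac_cf_complete_pos)
  \<comment> \<open>With the induction hypothesis solved for \<open>cf_diff \<theta> k\<close>, the
    summand 1/x of the partial quotient cancels this term in the recurrence.\<close>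
  have "cf_diff \<theta> k = - cf_diff \<theta> (Suc k) / x"
    using Suc x unfolding x_def[symmetric] by simp
  moreover have "real (cf_a \<theta> (Suc (Suc k))) = 1 / x - frac (cf_complete \<theta> (Suc (Suc k)))"
    unfolding x_def by (rule cf_a_Suc)
  ultimately show ?case
    unfolding cf_diff_Suc_Suc by (simp only:) (simp add: field_simps)
qed

lemma cf_diff_nonzero: "cf_diff \<theta> k \<noteq> 0"
proof (induction k)
  case 0
  then show ?case using slope_pos by (simp add: cf_diff_0)
next
  case (Suc k)
  then show ?case using frac_cf_complete_pos[of "Suc k"]
    by (simp add: cf_diff_Suc del: cf_complete.simps)
qed

lemma cf_diff_alternates: "cf_diff \<theta> k * cf_diff \<theta> (Suc k) < 0"
proof -
  have "0 < (cf_diff \<theta> k * cf_diff \<theta> k) * frac (cf_complete \<theta> (Suc k))"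
    using cf_diff_nonzero[of k] frac_cf_complete_pos[of "Suc k"]
    by (metis mult_pos_pos not_real_square_gt_zero)
  then show ?thesis by (simp add: cf_diff_Suc mult.assoc del: cf_complete.simps)
qed

section \<open>Best approximation by convergents\<close>

lemma cf_determinant:
  "\<bar>int (cf_q \<theta> (Suc k)) * int (cf_p \<theta> k) - int (cf_q \<theta> k) * int (cf_p \<theta> (Suc k))\<bar> = 1"
proof (induction k)
  case (Suc k)
  have "int (cf_q \<theta> (Suc (Suc k))) * int (cf_p \<theta> (Suc k))
          - int (cf_q \<theta> (Suc k)) * int (cf_p \<theta> (Suc (Suc k)))
        = - (int (cf_q \<theta> (Suc k)) * int (cf_p \<theta> k) - int (cf_q \<theta> k) * int (cf_p \<theta> (Suc k)))"
    by (simp add: algebra_simps)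
  then show ?case using Suc by simp
qed simp

text \<open>The vector (n, m) is written in the unimodular basis (q_k, p_k), (q_{k+1}, p_{k+1}) with
  coordinates x and y. The bounds on n force x to be nonzero and x y \<le> 0. Consecutive errors
  have opposite signs, so the two contributions do not cancel, and the first one alone is large
  enough.\<close>

lemma cf_best_approximation:
  fixes n m :: int
  assumes "0 < n" and "n < int (cf_q \<theta> (Suc k))"
  shows "\<bar>cf_diff \<theta> k\<bar> \<le> \<bar>of_int n * \<theta> - of_int m\<bar>"
proof -
  define q q' p p' where defs: "q = int (cf_q \<theta> k)" "q' = int (cf_q \<theta> (Suc k))"
    "p = int (cf_p \<theta> k)" "p' = int (cf_p \<theta> (Suc k))"
  define D where "D = q' * p - q * p'"
  \<comment> \<open>Cramer's rule; D is 1 or -1 and hence its own inverse.\<close>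
  define x y where xy: "x = D * (m * q' - n * p')" "y = D * (n * p - m * q)"
  have "\<bar>D\<bar> = 1" unfolding D_def defs by (rule cf_determinant)
  then have DD: "D * D = 1" by (metis abs_mult_self_eq mult_1)
  have "x * q + y * q' = (D * D) * n" "x * p + y * p' = (D * D) * m"
    unfolding xy by (simp_all add: D_def algebra_simps)
  then have n: "n = x * q + y * q'" and m: "m = x * p + y * p'"
    using DD by simp_all
  define d d' where dd: "d = cf_diff \<theta> k" "d' = cf_diff \<theta> (Suc k)"
  have d: "d = of_int q * \<theta> - of_int p" "d' = of_int q' * \<theta> - of_int p'"
    by (simp_all add: dd defs cf_diff_def)
  have eq: "of_int n * \<theta> - of_int m = of_int x * d + of_int y * d'"
    unfolding n m d by (simp add: algebra_simps)
  have alt: "d * d' < 0" unfolding dd by (rule cf_diff_alternates)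
  have pos: "0 < q" "0 < q'" using cf_q_pos by (simp_all add: defs)
  have bounds: "0 < n" "n < q'" using assms by (simp_all add: defs)
  have "x \<noteq> 0"
  proof
    assume "x = 0"
    then have *: "n = y * q'" using n by simp
    then have "0 < y" using bounds pos by (simp add: zero_less_mult_iff)
    then have "1 * q' \<le> y * q'" using pos by (intro mult_right_mono) auto
    then show False using * bounds by linarith
  qed
  \<comment> \<open>Two positive coordinates would give n > q', two negative ones n < 0.\<close>
  have "x * y \<le> 0"
  proof (rule ccontr)
    assume "\<not> x * y \<le> 0"
    then consider "0 < x" "0 < y" | "x < 0" "y < 0"
      by (auto simp: not_le zero_less_mult_iff)
    then show False
    proof cases
      case 1
      then have "1 * q' \<le> y * q'" "0 < x * q" using pos by (auto intro: mult_right_mono)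
      then show False using n bounds by linarith
    next
      case 2
      then have "x * q < 0" "y * q' < 0" using pos by (auto simp: mult_less_0_iff)
      then show False using n bounds by linarith
    qed
  qed
  then have "0 \<le> of_int (x * y) * (d * d')"
    using alt by (intro mult_nonpos_nonpos) (simp_all only: of_int_le_0_iff less_imp_le)
  then have "0 \<le> (of_int x * d) * (of_int y * d')" by (simp add: algebra_simps)
  then have "\<bar>of_int x * d + of_int y * d'\<bar> = \<bar>of_int x * d\<bar> + \<bar>of_int y * d'\<bar>"
    by (auto simp: zero_le_mult_iff)
  moreover have "\<bar>of_int x\<bar> * \<bar>d\<bar> \<ge> 1 * \<bar>d\<bar>"
    using \<open>x \<noteq> 0\<close> by (intro mult_right_mono) linarith+
  ultimately show ?thesis unfolding eq dd[symmetric] by (simp add: abs_mult add_increasing2)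
qed

text \<open>Adding q_k to n moves the multiple of \<theta> by p_k plus the error
  \<open>cf_diff \<theta> k\<close>. By best approximation this error is at most the distance to any
  integer, so no integer is crossed.\<close>

lemma floor_shift_cf_q:
  assumes "0 < n" and "n < cf_q \<theta> (Suc k)"
  shows "\<lfloor>real (n + cf_q \<theta> k) * \<theta>\<rfloor> = \<lfloor>real n * \<theta>\<rfloor> + int (cf_p \<theta> k)"
proof -
  define d where "d = cf_diff \<theta> k"
  have approx: "\<bar>d\<bar> \<le> \<bar>real n * \<theta> - of_int m\<bar>" for m
    using cf_best_approximation[of "int n" k m] assms by (simp add: d_def)
  have sum: "real (n + cf_q \<theta> k) * \<theta> = real n * \<theta> + d + of_int (int (cf_p \<theta> k))"
    by (simp add: d_def cf_diff_def algebra_simps)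
  \<comment> \<open>The approximation bound leaves equality open; irrationality excludes that the
    shifted point is an integer.\<close>
  have "real n * \<theta> + d \<noteq> of_int m" for m
  proof
    assume "real n * \<theta> + d = of_int m"
    then have "of_int (int (n + cf_q \<theta> k)) * \<theta> + of_int (- int (cf_p \<theta> k)) = of_int m"
      using sum by simp
    then show False
      using irrational_linear_not_Int[OF irrational, of "int (n + cf_q \<theta> k)" "- int (cf_p \<theta> k)"]
        assms by (metis Ints_of_int add_gr_0 of_nat_0_less_iff order_less_irrefl)
  qed
  note nonint = this
  have "\<lfloor>real n * \<theta> + d\<rfloor> = \<lfloor>real n * \<theta>\<rfloor>"
    using approx[of "\<lfloor>real n * \<theta>\<rfloor>"] approx[of "\<lfloor>real n * \<theta>\<rfloor> + 1"]
      nonint[of "\<lfloor>real n * \<theta>\<rfloor>"] nonint[of "\<lfloor>real n * \<theta>\<rfloor> + 1"]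
    by (intro floor_unique) (auto simp: abs_if split: if_splits; linarith)+
  then show ?thesis unfolding sum by (simp only: floor_add_int[symmetric])
qed

section \<open>The characteristic word\<close>

lemma lower_sturmian_slope:
  "lower_sturmian \<theta> \<theta> i = \<lfloor>real (i + 2) * \<theta>\<rfloor> - \<lfloor>real (i + 1) * \<theta>\<rfloor>"
  by (simp add: lower_sturmian_def lower_letter_def algebra_simps)

text \<open>With intercept \<theta>, position i involves the multiples i + 1 and i + 2. Both are
  positive and below q_{k+1}, so both floors shift by the same p_k.\<close>

lemma characteristic_period:
  assumes "i + 2 < cf_q \<theta> (Suc k)"
  shows "lower_sturmian \<theta> \<theta> (i + cf_q \<theta> k) = lower_sturmian \<theta> \<theta> i"
  using floor_shift_cf_q[of "i + 2" k] floor_shift_cf_q[of "i + 1" k] assms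
  by (simp add: lower_sturmian_slope add_ac)

lemma length_M_word_slope: "length (M_word \<theta> k) = cf_q \<theta> k"
  using slope_ge_0 slope_less_1 irrational by (rule length_M_word)

text \<open>The error of index 1 is a_1 \<theta> - 1 and lies strictly between -\<theta> and
  0.\<close>

lemma floor_mult_slope_eq_0: "n \<le> cf_a \<theta> 1 \<Longrightarrow> \<lfloor>real n * \<theta>\<rfloor> = 0"
  and floor_mult_slope_eq_1: "\<lfloor>real (cf_a \<theta> 1 + 1) * \<theta>\<rfloor> = 1"
proof -
  have d: "cf_diff \<theta> (Suc 0) = real (cf_a \<theta> 1) * \<theta> - 1" by (simp add: cf_diff_def)
  have neg: "cf_diff \<theta> (Suc 0) < 0"
    using cf_diff_alternates[of 0] slope_pos by (simp add: cf_diff_0 mult_less_0_iff)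
  have "\<theta> * frac (cf_complete \<theta> (Suc 0)) < \<theta> * 1"
    using slope_pos frac_lt_1 by (rule mult_strict_left_mono[rotated])
  then have gt: "- cf_diff \<theta> (Suc 0) < \<theta>"
    by (simp add: cf_diff_Suc cf_diff_0 del: cf_complete.simps)
  show "\<lfloor>real n * \<theta>\<rfloor> = 0" if "n \<le> cf_a \<theta> 1"
  proof -
    have "real n * \<theta> \<le> real (cf_a \<theta> 1) * \<theta>"
      using that slope_pos by (intro mult_right_mono) auto
    then show ?thesis using neg d slope_ge_0 by (simp add: floor_eq_iff)
  qed
  show "\<lfloor>real (cf_a \<theta> 1 + 1) * \<theta>\<rfloor> = 1"
    using neg gt d slope_less_1 by (intro floor_unique) (simp_all add: algebra_simps)
qed

lemma characteristic_1:
  assumes "i < cf_a \<theta> 1"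
  shows "lower_sturmian \<theta> \<theta> i = (if i = cf_a \<theta> 1 - 1 then 1 else 0)"
proof (cases "i = cf_a \<theta> 1 - 1")
  case True
  then have "i + 1 = cf_a \<theta> 1" "i + 2 = cf_a \<theta> 1 + 1" using assms by simp_all
  then show ?thesis
    using True floor_mult_slope_eq_0[of "i + 1"] floor_mult_slope_eq_1
    by (simp only: lower_sturmian_slope) simp
next
  case False
  then have "i + 1 \<le> cf_a \<theta> 1" "i + 2 \<le> cf_a \<theta> 1" using assms by simp_all
  then show ?thesis
    using False floor_mult_slope_eq_0 by (simp only: lower_sturmian_slope) simp
qed

text \<open>This is the last letter of M_2, contributed by M_0 = 0. For a_1 = 1 the period q_1 does
  not reach it, so it is computed directly: the multiples q_2 and q_2 + 1 of \<theta> both have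
  floor p_2.\<close>

lemma characteristic_at_cf_q_2: "lower_sturmian \<theta> \<theta> (cf_a \<theta> 2 * cf_q \<theta> 1) = 0"
proof -
  have q2: "cf_q \<theta> 2 = cf_a \<theta> 2 * cf_q \<theta> 1 + 1" by (simp add: numeral_2_eq_2)
  define d where "d = cf_diff \<theta> 2"
  have d1: "cf_diff \<theta> (Suc 0) = real (cf_a \<theta> 1) * \<theta> - 1" by (simp add: cf_diff_def)
  have neg: "cf_diff \<theta> (Suc 0) < 0"
    using cf_diff_alternates[of 0] slope_pos by (simp add: cf_diff_0 mult_less_0_iff)
  have pos: "0 < d"
    using cf_diff_alternates[of 1] neg by (simp add: d_def mult_less_0_iff numeral_2_eq_2)
  have "- cf_diff \<theta> (Suc 0) * frac (cf_complete \<theta> 2) < - cf_diff \<theta> (Suc 0) * 1"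
    using neg frac_lt_1 by (intro mult_strict_left_mono) auto
  then have "d < - cf_diff \<theta> (Suc 0)"
    using cf_diff_Suc[of 1] by (simp add: d_def numeral_2_eq_2 del: cf_complete.simps)
  moreover have "1 * \<theta> \<le> real (cf_a \<theta> 1) * \<theta>"
    using slope_pos cf_a_Suc_pos[of 0] by (intro mult_right_mono) auto
  ultimately have less: "d + \<theta> < 1" using d1 by simp
  have eq: "real (cf_q \<theta> 2) * \<theta> = d + real (cf_p \<theta> 2)" by (simp add: d_def cf_diff_def)
  have "\<lfloor>real (cf_q \<theta> 2) * \<theta>\<rfloor> = int (cf_p \<theta> 2)"
    unfolding eq using pos less slope_pos by (intro floor_unique) simp_all
  moreover have "\<lfloor>real (cf_q \<theta> 2 + 1) * \<theta>\<rfloor> = int (cf_p \<theta> 2)"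
    using eq pos less slope_pos by (intro floor_unique) (simp_all add: distrib_right)
  ultimately show ?thesis unfolding lower_sturmian_slope q2 by simp
qed

text \<open>The period q_{k+1} can be subtracted repeatedly, since i - q_{k+1} + 2 < q_{k+2} for
  every such i that is at least q_{k+1}.\<close>

lemma characteristic_blocks:
  assumes "i < cf_a \<theta> (Suc (Suc k)) * cf_q \<theta> (Suc k)"
  shows "lower_sturmian \<theta> \<theta> i = lower_sturmian \<theta> \<theta> (i mod cf_q \<theta> (Suc k))"
  using assms
proof (induction i rule: less_induct)
  case (less i)
  let ?q = "cf_q \<theta> (Suc k)"
  show ?case
  proof (cases "i < ?q")
    case False
    then have i: "i - ?q < i" "i = i - ?q + ?q" using cf_q_pos[of "Suc k"] by auto
    have "lower_sturmian \<theta> \<theta> i = lower_sturmian \<theta> \<theta> (i - ?q)"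
      using characteristic_period[of "i - ?q" "Suc k"] less.prems i cf_q_pos[of k]
        cf_q_pos[of "Suc k"] by simp
    also have "\<dots> = lower_sturmian \<theta> \<theta> ((i - ?q) mod ?q)"
      using less.IH[OF i(1)] less.prems by simp
    finally show ?thesis using False by (simp add: le_mod_geq)
  qed simp
qed

text \<open>Strong induction: the power in the recursion is read off from the period, and the final
  factor is carried back to the start of the word. Indices start at 1 because M_0 = 0 is not a
  prefix of the characteristic word when a_1 = 1.\<close>

lemma M_word_nth:
  assumes "i < cf_q \<theta> (Suc k)"
  shows "M_word \<theta> (Suc k) ! i = lower_sturmian \<theta> \<theta> i"
  using assms
proof (induction k arbitrary: i rule: less_induct)
  case (less k)
  show ?case
  proof (cases k)
    case 0
    then show ?thesis
      using less.prems characteristic_1[of i]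
      by (auto simp: word_power_singleton nth_append)
  next
    case (Suc j)
    let ?a = "cf_a \<theta> (Suc (Suc j))" and ?q = "cf_q \<theta> (Suc j)"
    have len: "length (word_power (M_word \<theta> (Suc j)) ?a) = ?a * ?q"
      by (simp only: length_word_power length_M_word_slope)
    show ?thesis
    proof (cases "i < ?a * ?q")
      case True
      have "M_word \<theta> (Suc k) ! i = M_word \<theta> (Suc j) ! (i mod ?q)"
        using True len
        by (simp add: Suc nth_append nth_word_power length_M_word_slope del: cf_q.simps)
      also have "\<dots> = lower_sturmian \<theta> \<theta> (i mod ?q)"
        using less.IH[of j] Suc cf_q_pos[of "Suc j"] by simp
      also have "\<dots> = lower_sturmian \<theta> \<theta> i"
        using characteristic_blocks[OF True] by simp
      finally show ?thesis .
    next
      case False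
      define l where "l = i - ?a * ?q"
      have l: "l < cf_q \<theta> j" "i = l + ?a * ?q"
        using False less.prems by (auto simp: l_def Suc)
      have M: "M_word \<theta> (Suc k) ! i = M_word \<theta> j ! l"
        using len l by (simp add: Suc nth_append del: cf_q.simps)
      show ?thesis
      proof (cases j)
        case 0
        then show ?thesis
          using M l characteristic_at_cf_q_2 by (simp add: numeral_2_eq_2)
      next
        case (Suc h)
        \<comment> \<open>This gives \<open>i - ?q + 2 \<le> i\<close>, which is what the shift back
          by one period requires.\<close>
        have ge2: "2 \<le> ?q" using cf_q_strict[of h] cf_q_pos[of "Suc h"] Suc by simp
        have a: "?a = Suc (?a - 1)" using cf_a_Suc_pos[of "Suc j"] by simp
        have i: "i = (l + (?a - 1) * ?q) + ?q"
          using l(2) by (subst (asm) a) simp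
        have "(l + (?a - 1) * ?q) + 2 < cf_q \<theta> (Suc (Suc j))"
          using i l ge2 by simp
        then have "lower_sturmian \<theta> \<theta> i = lower_sturmian \<theta> \<theta> (l + (?a - 1) * ?q)"
          unfolding i by (rule characteristic_period)
        also have "l < ?q" using l(1) cf_q_strict[of h] Suc by simp
        then have "lower_sturmian \<theta> \<theta> (l + (?a - 1) * ?q) = lower_sturmian \<theta> \<theta> l"
          using characteristic_blocks[of "l + (?a - 1) * ?q" j] a
          by (metis add_less_cancel_right mod_less mod_mult_self1 mult_Suc)
        also have "\<dots> = M_word \<theta> j ! l"
          using less.IH[of h] l(1) Suc \<open>k = Suc j\<close> by simp
        finally show ?thesis using M by simp
      qed
    qed
  qed
qed

end

section \<open>Rotations by Ostrowski digits\<close>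

text \<open>The condition \<open>b 1 < cf_a \<theta> 1\<close> is the bound \<open>b 1 \<le> cf_a \<theta> 1 - 1\<close> without truncated
  subtraction.\<close>

locale ostrowski_digits = irrational_slope +
  fixes b :: "nat \<Rightarrow> nat"
  assumes digit_1: "b 1 < cf_a \<theta> 1"
    and digit_le: "b (Suc (Suc k)) \<le> cf_a \<theta> (Suc (Suc k))"
    and digit_max: "b (Suc (Suc k)) = cf_a \<theta> (Suc (Suc k)) \<Longrightarrow> b (Suc k) = 0"
begin

lemma ost_t_0: "ost_t \<theta> b 0 = 0"
  by (simp add: ost_t_def)

lemma ost_t_Suc: "ost_t \<theta> b (Suc k) = ost_t \<theta> b k + b (Suc k) * cf_q \<theta> k"
  by (simp add: ost_t_def)

text \<open>A digit below its maximum leaves room for one more q_{k+1}, which exceeds the lower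
  part. After a maximal digit the preceding one vanishes, and the rest is below q_k.\<close>

lemma ost_t_less: "ost_t \<theta> b k < cf_q \<theta> k"
proof (induction k rule: induct_nat_012)
  case 0
  then show ?case by (simp add: ost_t_0)
next
  case 1
  then show ?case using digit_1 by (simp add: ost_t_0 ost_t_Suc)
next
  case (ge2 k)
  show ?case
  proof (cases "b (Suc (Suc k)) = cf_a \<theta> (Suc (Suc k))")
    case True
    then have "ost_t \<theta> b (Suc k) = ost_t \<theta> b k" using digit_max by (simp add: ost_t_Suc)
    then show ?thesis using True ge2 by (simp add: ost_t_Suc[of "Suc k"])
  next
    case False
    then have "Suc (b (Suc (Suc k))) \<le> cf_a \<theta> (Suc (Suc k))" using digit_le[of k] by simp
    then have "Suc (b (Suc (Suc k))) * cf_q \<theta> (Suc k)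
        \<le> cf_a \<theta> (Suc (Suc k)) * cf_q \<theta> (Suc k)"
      by (rule mult_le_mono1)
    then show ?thesis using ge2 by (simp add: ost_t_Suc[of "Suc k"])
  qed
qed

text \<open>An explicit factorization of T_k into powers of the M_j, which turns the rotation claim
  into an identity between words.\<close>

primrec digit_word :: "nat \<Rightarrow> int list" where
  "digit_word 0 = []"
| "digit_word (Suc k) = word_power (M_word \<theta> k) (b (Suc k)) @ digit_word k"

lemma length_digit_word: "length (digit_word k) = ost_t \<theta> b k"
  by (induction k) (simp_all add: ost_t_0 ost_t_Suc length_word_power length_M_word_slope)

lemma V_word_rotates_M_word:
  "\<exists>R. M_word \<theta> k = digit_word k @ R \<and> V_word \<theta> b k = R @ digit_word k"
proof (induction k rule: induct_nat_012)
  case 0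
  then show ?case by simp
next
  case 1
  have "cf_a \<theta> 1 - 1 = b 1 + (cf_a \<theta> 1 - b 1 - 1)" using digit_1 by simp
  then have "M_word \<theta> (Suc 0) = word_power [0] (b 1) @ word_power [0] (cf_a \<theta> 1 - b 1 - 1) @ [1]"
    by (metis M_word.simps(2) append_assoc word_power_add)
  then show ?case by simp
next
  case (ge2 k)
  let ?a = "cf_a \<theta> (Suc (Suc k))" and ?b = "b (Suc (Suc k))"
  obtain R where M: "M_word \<theta> k = digit_word k @ R" and V: "V_word \<theta> b k = R @ digit_word k"
    using ge2 by blast
  obtain R' where M': "M_word \<theta> (Suc k) = digit_word (Suc k) @ R'"
    and V': "V_word \<theta> b (Suc k) = R' @ digit_word (Suc k)"
    using ge2 by blast
  show ?case
  proof (cases "?b = ?a")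
    case True
    \<comment> \<open>The digit before a maximal one vanishes, so both indices share the same T, and
      the complement R of M_k also serves for M_{k+2}.\<close>
    then have T: "digit_word (Suc k) = digit_word k" using digit_max by simp
    have "M_word \<theta> (Suc (Suc k)) = digit_word (Suc (Suc k)) @ R"
      using M T True by simp
    moreover have "V_word \<theta> b (Suc (Suc k)) = R @ digit_word (Suc (Suc k))"
      using M' V V' T True
      by (simp add: word_power_rotate del: digit_word.simps)
        (simp add: T word_power_rotate)
    ultimately show ?thesis by blast
  next
    case False
    define c where "c = ?a - ?b - 1"
    have a: "?a = ?b + Suc c" using False digit_le[of k] by (simp add: c_def)
    define T where "T = digit_word (Suc k)"
    \<comment> \<open>T is a power of M_k followed by T_k, and V_k = R T_k, so T_k R = M_k
      reassembles and commutes past the power.\<close>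
    have comm: "T @ V_word \<theta> b k = M_word \<theta> k @ T"
    proof -
      have "T @ V_word \<theta> b k = word_power (M_word \<theta> k) (b (Suc k)) @ M_word \<theta> k @ digit_word k"
        by (simp add: T_def V M)
      also have "\<dots> = M_word \<theta> k @ T"
        by (simp add: T_def word_power_commute_append)
      finally show ?thesis .
    qed
    \<comment> \<open>The word M_{k+2} is cut inside factor number \<open>?b + 1\<close> of its
      power, just after T.\<close>
    define S where "S = R' @ word_power (M_word \<theta> (Suc k)) c @ M_word \<theta> k"
    have "M_word \<theta> (Suc (Suc k)) = digit_word (Suc (Suc k)) @ S"
      by (simp only: M_word.simps digit_word.simps(2)[of "Suc k"] a word_power_add word_power_Suc
          append_assoc S_def) (simp only: M' append_assoc)
    moreover have "V_word \<theta> b (Suc (Suc k)) = S @ digit_word (Suc (Suc k))"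
    proof -
      have "V_word \<theta> b (Suc (Suc k))
          = word_power (R' @ T) (Suc c) @ V_word \<theta> b k @ word_power (R' @ T) ?b"
        by (simp add: a V' T_def)
      also have "\<dots> = R' @ word_power (T @ R') c @ (T @ V_word \<theta> b k) @ word_power (R' @ T) ?b"
        by (metis append_assoc word_power_Suc word_power_commute word_power_rotate)
      also have "\<dots> = R' @ word_power (T @ R') c @ M_word \<theta> k @ word_power (T @ R') ?b @ T"
        unfolding comm by (simp add: word_power_rotate)
      also have "\<dots> = S @ digit_word (Suc (Suc k))"
        using M' by (simp add: S_def T_def)
      finally show ?thesis .
    qed
    ultimately show ?thesis by blast
  qed
qed

text \<open>Lengths identify the prefix and suffix with the two factors of the rotation; t_k < q_k
  keeps the subtraction in r_k from truncating.\<close>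

lemma T_word_append_R_word: "T_word \<theta> b k @ R_word \<theta> b k = M_word \<theta> k"
  and V_word_eq_R_word_append_T_word: "V_word \<theta> b k = R_word \<theta> b k @ T_word \<theta> b k"
proof -
  obtain R where M: "M_word \<theta> k = digit_word k @ R" and V: "V_word \<theta> b k = R @ digit_word k"
    using V_word_rotates_M_word by blast
  have "T_word \<theta> b k = digit_word k"
    by (simp add: T_word_def word_prefix_def M flip: length_digit_word)
  moreover have "length (M_word \<theta> k) - ost_r \<theta> b k = length (digit_word k)"
    using ost_t_less[of k] by (simp add: length_M_word_slope ost_r_def length_digit_word)
  then have "R_word \<theta> b k = R"
    by (simp add: R_word_def word_suffix_def) (simp add: M)
  ultimately show "T_word \<theta> b k @ R_word \<theta> b k = M_word \<theta> k"
    "V_word \<theta> b k = R_word \<theta> b k @ T_word \<theta> b k"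
    using M V by simp_all
qed

section \<open>Letters of V_k\<close>

lemma length_V_word: "length (V_word \<theta> b k) = cf_q \<theta> k"
  using V_word_rotates_M_word[of k] length_M_word_slope[of k] by auto

lemma V_word_nth_characteristic:
  assumes "i < cf_q \<theta> (Suc k)"
  shows "V_word \<theta> b (Suc k) ! i = lower_sturmian \<theta> \<theta> (i + ost_t \<theta> b (Suc k))"
proof -
  let ?q = "cf_q \<theta> (Suc k)" and ?t = "ost_t \<theta> b (Suc k)"
  obtain R where M: "M_word \<theta> (Suc k) = digit_word (Suc k) @ R"
    and V: "V_word \<theta> b (Suc k) = R @ digit_word (Suc k)"
    using V_word_rotates_M_word by blast
  have T: "length (digit_word (Suc k)) = ?t" by (rule length_digit_word)
  have R: "length R + ?t = ?q"
    using length_M_word_slope[of "Suc k"] T by (simp add: M del: digit_word.simps)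
  show ?thesis
  proof (cases "i < length R")
    case True
    then have "V_word \<theta> b (Suc k) ! i = M_word \<theta> (Suc k) ! (i + ?t)"
      using T by (simp add: M V nth_append del: digit_word.simps)
    then show ?thesis using True R M_word_nth[of "i + ?t" k] by simp
  next
    case False
    define j where "j = i - length R"
    have j: "j < ?t" "i + ?t = j + ?q" using False assms R by (simp_all add: j_def)
    have "V_word \<theta> b (Suc k) ! i = M_word \<theta> (Suc k) ! j"
      using T j False by (simp add: M V nth_append j_def del: digit_word.simps)
    also have "\<dots> = lower_sturmian \<theta> \<theta> j"
      using j ost_t_less[of "Suc k"] by (intro M_word_nth) simp
    \<comment> \<open>The period applies because \<open>j + 2 \<le> ?t + 1 \<le> ?q\<close>, which
      is below the next denominator.\<close>
    also have "\<dots> = lower_sturmian \<theta> \<theta> (j + ?q)"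
      using j ost_t_less[of "Suc k"] cf_q_strict[of k]
      by (intro characteristic_period[symmetric]) simp
    finally show ?thesis using j by simp
  qed
qed

lemma ostrowski_partial_sum:
  "(\<Sum>h<k. real (b (Suc h)) * cf_diff \<theta> h)
     = real (ost_t \<theta> b k) * \<theta> - of_int (\<Sum>h<k. int (b (Suc h) * cf_p \<theta> h))"
  by (induction k) (simp_all add: ost_t_0 ost_t_Suc cf_diff_def algebra_simps)

text \<open>The intercept differs by an integer from (t_{k+1} + 1) \<theta>, and that integer
  cancels in the difference of floors.\<close>

lemma V_word_nth:
  assumes "i < cf_q \<theta> (Suc k)"
  shows "V_word \<theta> b (Suc k) ! i
    = lower_sturmian \<theta> (\<theta> + (\<Sum>h<Suc k. real (b (Suc h)) * cf_diff \<theta> h)) i"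
proof -
  let ?t = "ost_t \<theta> b (Suc k)" and ?N = "\<Sum>h<Suc k. int (b (Suc h) * cf_p \<theta> h)"
  let ?\<rho> = "\<theta> + (\<Sum>h<Suc k. real (b (Suc h)) * cf_diff \<theta> h)"
  have "real (Suc i) * \<theta> + ?\<rho> = real (i + ?t + 2) * \<theta> - of_int ?N"
    and "(real (Suc i) - 1) * \<theta> + ?\<rho> = real (i + ?t + 1) * \<theta> - of_int ?N"
    unfolding ostrowski_partial_sum by (simp_all only: of_nat_add of_nat_Suc of_nat_numeral of_nat_1)
      (simp_all add: algebra_simps)
  then have "lower_sturmian \<theta> ?\<rho> i = lower_sturmian \<theta> \<theta> (i + ?t)"
    unfolding lower_sturmian_slope unfolding lower_sturmian_def lower_letter_def
    by (simp only: floor_diff_of_int)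
  then show ?thesis using V_word_nth_characteristic[OF assms] by simp
qed

end

section \<open>Convergence\<close>

text \<open>The floor function is locally constant away from the integers.\<close>

lemma eventually_floor_eq:
  fixes f :: "'a \<Rightarrow> real"
  assumes "(f \<longlongrightarrow> x) F" and "x \<notin> \<int>"
  shows "\<forall>\<^sub>F k in F. \<lfloor>f k\<rfloor> = \<lfloor>x\<rfloor>"
proof -
  have "of_int \<lfloor>x\<rfloor> < x"
    using assms(2) by (metis Ints_of_int of_int_floor_le order_le_less)
  moreover have "x < of_int \<lfloor>x\<rfloor> + 1" by linarith
  ultimately have "\<forall>\<^sub>F k in F. of_int \<lfloor>x\<rfloor> < f k" "\<forall>\<^sub>F k in F. f k < of_int \<lfloor>x\<rfloor> + 1"
    using assms(1) by (auto intro: order_tendstoD)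
  then show ?thesis
    by eventually_elim (simp add: floor_eq_iff)
qed

lemma eventually_lower_sturmian_eq:
  assumes "(f \<longlongrightarrow> \<rho>) F" and "\<And>n::nat. real n * \<theta> + \<rho> \<notin> \<int>"
  shows "\<forall>\<^sub>F k in F. lower_sturmian \<theta> (f k) i = lower_sturmian \<theta> \<rho> i"
proof -
  have "\<forall>\<^sub>F k in F. \<lfloor>real n * \<theta> + f k\<rfloor> = \<lfloor>real n * \<theta> + \<rho>\<rfloor>" for n
    using assms by (intro eventually_floor_eq tendsto_intros)
  from this[of "Suc i"] this[of i] show ?thesis
    by eventually_elim (simp add: lower_sturmian_def lower_letter_def)
qed

text \<open>Off the integers the ceiling is the floor plus one, and this constant cancels.\<close>

lemma lower_sturmian_eq_upper_sturmian:
  assumes "\<And>n::nat. real n * \<theta> + \<rho> \<notin> \<int>"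
  shows "lower_sturmian \<theta> \<rho> = upper_sturmian \<theta> \<rho>"
proof
  fix i
  have "\<lceil>real n * \<theta> + \<rho>\<rceil> = \<lfloor>real n * \<theta> + \<rho>\<rfloor> + 1" for n
    using assms[of n] by (metis Ints_of_int ceiling_altdef)
  from this[of "Suc i"] this[of i]
  show "lower_sturmian \<theta> \<rho> i = upper_sturmian \<theta> \<rho> i"
    by (simp add: lower_sturmian_def upper_sturmian_def lower_letter_def upper_letter_def)
qed

lemma (in ostrowski_digits) V_word_tendsto:
  assumes "(\<lambda>k. real (b (Suc k)) * cf_diff \<theta> k) sums (\<rho> - \<theta>)"
    and "\<And>n::nat. real n * \<theta> + \<rho> \<notin> \<int>"
  shows "words_tendsto (V_word \<theta> b) (lower_sturmian \<theta> \<rho>)"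
  unfolding words_tendsto_def
proof
  fix n
  let ?\<rho> = "\<lambda>k. \<theta> + (\<Sum>h<k. real (b (Suc h)) * cf_diff \<theta> h)"
  have "?\<rho> \<longlonglongrightarrow> \<theta> + (\<rho> - \<theta>)"
    using assms(1) unfolding sums_def by (intro tendsto_intros)
  then have "?\<rho> \<longlonglongrightarrow> \<rho>" by simp
  then have "\<forall>\<^sub>F k in sequentially. \<forall>i\<in>{..<n}. lower_sturmian \<theta> (?\<rho> k) i = lower_sturmian \<theta> \<rho> i"
    using assms(2) by (intro eventually_ball_finite ballI eventually_lower_sturmian_eq) auto
  \<comment> \<open>This makes k a successor, as the letter formula requires, and gives n \<le>
    q_k.\<close>
  moreover have "\<forall>\<^sub>F k in sequentially. Suc n \<le> k" by (rule eventually_ge_at_top)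
  ultimately show "\<forall>\<^sub>F k in sequentially. n \<le> length (V_word \<theta> b k) \<and>
      take n (V_word \<theta> b k) = map (lower_sturmian \<theta> \<rho>) [0..<n]"
  proof eventually_elim
    case (elim k)
    then obtain j where k: "k = Suc j" by (cases k) auto
    have n: "n \<le> cf_q \<theta> (Suc j)" using cf_q_ge[of "Suc j"] elim k by simp
    have "V_word \<theta> b k ! i = lower_sturmian \<theta> \<rho> i" if "i < n" for i
      using V_word_nth[of i j] that n elim(1) unfolding k by simp
    then show ?case
      using n k by (auto simp: length_V_word intro!: nth_equalityI)
  qed
qed

theorem theorem2p1:
  fixes \<theta> \<rho> :: real
  assumes "0 \<le> \<theta>" and "\<theta> < 1" and "0 \<le> \<rho>" and "\<rho> < 1"
    and "\<theta> \<notin> \<rat>"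
    and "(\<nexists>m n :: int. \<rho> = of_int m * \<theta> + of_int n) \<or>
         (\<exists>m n :: int. m \<ge> 1 \<and> \<rho> = of_int m * \<theta> + of_int n)"
  shows "lower_sturmian \<theta> \<rho> = upper_sturmian \<theta> \<rho> \<and>
    (\<forall>b. ostrowski_expansion \<theta> (\<rho> - \<theta>) b \<longrightarrow>
       words_tendsto (V_word \<theta> b) (lower_sturmian \<theta> \<rho>) \<and>
       words_tendsto (V_word \<theta> b) (upper_sturmian \<theta> \<rho>) \<and>
       (\<forall>k\<ge>1. ost_t \<theta> b k \<le> cf_q \<theta> k \<and>
              V_word \<theta> b k = R_word \<theta> b k @ T_word \<theta> b k \<and>
              M_word \<theta> k = T_word \<theta> b k @ R_word \<theta> b k))"
proof (intro conjI allI impI)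
  have nonint: "real n * \<theta> + \<rho> \<notin> \<int>" for n :: nat
    using assms(6)
  proof
    assume none: "\<nexists>m n :: int. \<rho> = of_int m * \<theta> + of_int n"
    show ?thesis
    proof
      assume "real n * \<theta> + \<rho> \<in> \<int>"
      then obtain l where "real n * \<theta> + \<rho> = of_int l" by (rule Ints_cases)
      then have "\<rho> = of_int (- int n) * \<theta> + of_int l" by simp
      then show False using none by blast
    qed
  next
    assume "\<exists>m n :: int. m \<ge> 1 \<and> \<rho> = of_int m * \<theta> + of_int n"
    then obtain m l :: int where "m \<ge> 1" and \<rho>: "\<rho> = of_int m * \<theta> + of_int l" by blast
    \<comment> \<open>The coefficient n + m of \<theta> is positive, hence nonzero.\<close>
    then show ?thesis
      using irrational_linear_not_Int[OF assms(5), of "int n + m" l]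
      by (simp add: algebra_simps)
  qed
  show eq: "lower_sturmian \<theta> \<rho> = upper_sturmian \<theta> \<rho>"
    using nonint by (rule lower_sturmian_eq_upper_sturmian)
  fix b
  assume ost: "ostrowski_expansion \<theta> (\<rho> - \<theta>) b"
  interpret irrational_slope \<theta>
    using assms by unfold_locales
  \<comment> \<open>Positivity of a_1 turns the bound a_1 - 1 on the first digit into a strict
    inequality.\<close>
  interpret ostrowski_digits \<theta> b
    using ost cf_a_Suc_pos[of 0] by unfold_locales (auto simp: ostrowski_expansion_def)
  show tendsto: "words_tendsto (V_word \<theta> b) (lower_sturmian \<theta> \<rho>)"
    using ost nonint by (intro V_word_tendsto) (auto simp: ostrowski_expansion_def)
  then show "words_tendsto (V_word \<theta> b) (upper_sturmian \<theta> \<rho>)"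
    unfolding eq .
  fix k :: nat
  show "ost_t \<theta> b k \<le> cf_q \<theta> k"
    using ost_t_less[of k] by simp
  show "V_word \<theta> b k = R_word \<theta> b k @ T_word \<theta> b k"
    by (rule V_word_eq_R_word_append_T_word)
  show "M_word \<theta> k = T_word \<theta> b k @ R_word \<theta> b k"
    by (rule T_word_append_R_word[symmetric])
qed

end
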